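(* Let $(H,d)$ be a Hadamard space and $x\in H$. The following statements are true: (i) $(\Gamma_x(H),\tau_{w_\Gamma})$ is Hausdorff whenever $(H,d)$ is weakly proper. (ii) Any bounded sequence in $(\Gamma_x(H),d_1)$ has a weak-$\Gamma$ convergent subsequence. (iii) A closed convex set in $\Gamma_x(H)$ is weak-$\Gamma$ sequentially closed. If additionally the set is also bounded, then it is weak-$\Gamma$ sequentially compact. (iv) A bounded closed convex set in $\Gamma_x(H)$ is weak-$\Gamma$ compact whenever $H$ is separable.
   Context: A Hadamard space is a complete $\mathrm{CAT}(0)$ space. For $x\in H$, $\Gamma_x(H)$ is the set of all constant speed geodesics $\gamma:[0,1]\to H$ (i.e. $d(\gamma(s),\gamma(t))=|s-t|\,d(\gamma(0),\gamma(1))$ for all $s,t\in[0,1]$) with $\gamma(0)=x$, equipped with the metric $d_1(\gamma,\eta):=\sup_{t\in[0,1]}d(\gamma(t),\eta(t))$. "Closed" and "bounded" in $\Gamma_x(H)$ refer to $d_1$. For $\gamma_1,\gamma_2\in\Gamma_x(H)$ and $t\in[0,1]$, $\gamma_t=(1-t)\gamma_1\oplus t\gamma_2$ is the geodesic in $\Gamma_x(H)$ from $x$ to the point $(1-t)\gamma_1(1)\oplus t\gamma_2(1)$, i.e. the point on the geodesic segment $[\gamma_1(1),\gamma_2(1)]$ at distance $t\,d(\gamma_1(1),\gamma_2(1))$ from $\gamma_1(1)$. A subset of $\Gamma_x(H)$ is convex if it contains all $\gamma_t$, $t\in[0,1]$, whenever it contains $\gamma_1,\gamma_2$. For a geodesic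 $\gamma$, $P_\gamma$ denotes the metric projection onto (the image of) $\gamma$. Weak convergence in $H$: $x_n\overset{w}\to y$ means $P_\gamma x_n\to y$ for every $\gamma\in\Gamma_y(H)$. Weak-$\Gamma$ convergence in $\Gamma_x(H)$: $\gamma_n\overset{w_\Gamma}\to\gamma$ means $\gamma_n(1)\overset{w}\to\gamma(1)$. A set $S\subseteq\Gamma_x(H)$ is weak-$\Gamma$ sequentially closed if it contains the limit of every weak-$\Gamma$ convergent sequence of its elements; it is weak-$\Gamma$ sequentially compact if every sequence in $S$ has a subsequence weak-$\Gamma$ converging to an element of $S$. Weak topology $\tau_w$ on $H$: $U\subset H$ is weakly open if for every $y\in U$ there exist $\varepsilon>0$ and finitely many $\gamma_1,\dots,\gamma_n\in\Gamma_y(H)$ with $\{z\in H: d(y,P_{\gamma_i}z)<\varepsilon,\ i=1,\dots,n\}\subseteq U$. $H$ is weakly proper if for every $y\in H$, $\gamma\in\Gamma_y(H)$ and $\varepsilon>0$ there is $V\in\tau_w$ with $y\in V\subseteq\{z\in H: d(y,P_\gamma z)<\varepsilon\}$. Weak-$\Gamma$ topology $\tau_{w_\Gamma}$ on $\Gamma_x(H)$: $U\subseteq\Gamma_x(H)$ is weak-$\Gamma$ open if for every $\gamma\in U$ there exist $\varepsilon>0$ and finitely many $\gamma_1,\dots,\gamma_n\in\Gamma_{\gamma(1)}(H)$ with $\{\eta\in\Gamma_x(H): d(\gamma(1),P_{\gamma_i}\eta(1))<\varepsilon,\ i=1,\dots,n\}\subseteq U$. A set is weak-$\Gamma$ compact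 if it is compact with respect to $\tau_{w_\Gamma}$. *)

theory Defs
  imports "HOL-Analysis.Analysis"
begin

section \<open>Geodesics and Hadamard spaces\<close>

text \<open>Geodesics are total functions on the reals; extensionality makes them determined by their
  values on the unit interval.\<close>

definition (in metric_space) geodesics :: "'a \<Rightarrow> (real \<Rightarrow> 'a) set" where
  "geodesics x = {\<gamma> \<in> extensional {0..1}.
     \<gamma> 0 = x \<and> (\<forall>s\<in>{0..1}. \<forall>t\<in>{0..1}. dist (\<gamma> s) (\<gamma> t) = \<bar>s - t\<bar> * dist (\<gamma> 0) (\<gamma> 1))}"

text \<open>The second axiom compares each geodesic triangle with its Euclidean comparison triangle
  for points on the sides \<open>[a,b]\<close> and \<open>[b,c]\<close>. The other pairs of
  distinct sides are covered by cyclic relabelling of the vertices, and for two points on the same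
  side the comparison is an equality.\<close>

class hadamard_space = complete_space +
  assumes geodesics_exist: "\<exists>\<gamma>\<in>geodesics a. \<gamma> 1 = b"
    and triangle_comparison:
      "\<lbrakk>\<alpha> \<in> geodesics a; \<alpha> 1 = b; \<beta> \<in> geodesics b; \<beta> 1 = c; \<gamma> \<in> geodesics c; \<gamma> 1 = a;
        dist a' b' = dist a b; dist b' c' = dist b c; dist c' a' = dist c a;
        s \<in> {0..1}; t \<in> {0..1}\<rbrakk>
       \<Longrightarrow> dist (\<alpha> s) (\<beta> t) \<le>
           dist ((1 - s) *\<^sub>R a' + s *\<^sub>R b') ((1 - t) *\<^sub>R b' + t *\<^sub>R (c' :: real^2))"

lemma geodesicsD:
  assumes "\<gamma> \<in> geodesics a"
  shows "\<gamma> \<in> extensional {0..1}" "\<gamma> 0 = a"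
    "\<And>s t. s \<in> {0..1} \<Longrightarrow> t \<in> {0..1} \<Longrightarrow> dist (\<gamma> s) (\<gamma> t) = \<bar>s - t\<bar> * dist a (\<gamma> 1)"
    "\<And>s. s \<in> {0..1} \<Longrightarrow> dist a (\<gamma> s) = s * dist a (\<gamma> 1)"
proof -
  show 0: "\<gamma> \<in> extensional {0..1}" "\<gamma> 0 = a"
    using assms unfolding geodesics_def by blast+
  show 1: "dist (\<gamma> s) (\<gamma> t) = \<bar>s - t\<bar> * dist a (\<gamma> 1)" if "s \<in> {0..1}" "t \<in> {0..1}" for s t
    using assms that unfolding geodesics_def by blast
  show "dist a (\<gamma> s) = s * dist a (\<gamma> 1)" if "s \<in> {0..1}" for s
    using 1[of 0 s] that 0(2) by simp
qed

lemma geodesics_const: "restrict (\<lambda>_. a) {0..1} \<in> geodesics a"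
  by (auto simp: geodesics_def)

lemma geodesics_reverse:
  assumes "\<gamma> \<in> geodesics a" "\<gamma> 1 = b"
  shows "restrict (\<lambda>t. \<gamma> (1 - t)) {0..1} \<in> geodesics b"
proof -
  have "dist (\<gamma> (1 - s)) (\<gamma> (1 - t)) = \<bar>s - t\<bar> * dist b a"
    if "s \<in> {0..1}" "t \<in> {0..1}" for s t
    using geodesicsD(3)[OF assms(1), of "1 - s" "1 - t"] that assms(2)
    by (simp add: dist_commute[of a] abs_minus_commute[of t])
  then show ?thesis using assms geodesicsD(2)[OF assms(1)] by (simp add: geodesics_def)
qed

lemma geodesics_unique:
  fixes a b :: "'a::hadamard_space"
  assumes g: "\<gamma> \<in> geodesics a" "\<gamma> 1 = b" and h: "\<eta> \<in> geodesics a" "\<eta> 1 = b"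
  shows "\<gamma> = \<eta>"
proof (rule extensionalityI)
  show "\<gamma> \<in> extensional {0..1}" "\<eta> \<in> extensional {0..1}"
    using g h geodesicsD(1) by blast+
next
  fix t :: real assume t: "t \<in> {0..1}"
  define a' :: "real^2" where "a' = 0"
  define b' :: "real^2" where "b' = axis 1 (dist a b)"
  let ?r = "restrict (\<lambda>t. \<eta> (1 - t)) {0..1}" and ?k = "restrict (\<lambda>_. b) {0..1::real}"
  have r: "?r \<in> geodesics b" using geodesics_reverse[OF h] .
  have k: "?k \<in> geodesics b" by (rule geodesics_const)
  have ends: "?r 1 = a" "?k 1 = b" using geodesicsD(2)[OF h(1)] by simp_all
  have d: "dist b' a' = dist b a" "dist a' b' = dist a b" "dist b' b' = dist b b"
    by (simp_all add: a'_def b'_def dist_commute[of b] norm_eq_sqrt_inner inner_axis_axis)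
  have "dist (?r s) (\<gamma> u) \<le>
      dist ((1 - s) *\<^sub>R b' + s *\<^sub>R a') ((1 - u) *\<^sub>R a' + u *\<^sub>R b')"
    if "s \<in> {0..1}" "u \<in> {0..1}" for s u
    using triangle_comparison[OF r ends(1) g k ends(2) d that] .
  from this[of "1 - t" t] t h show "\<gamma> t = \<eta> t"
    by (simp add: add.commute[of "t *\<^sub>R b'"])
qed

definition geod :: "'a::hadamard_space \<Rightarrow> 'a \<Rightarrow> real \<Rightarrow> 'a" where
  "geod a b = (THE \<gamma>. \<gamma> \<in> geodesics a \<and> \<gamma> 1 = b)"

text \<open>The point at distance \<open>t * dist a b\<close> from \<open>a\<close> on the geodesic segment
  joining \<open>a\<close> to \<open>b\<close>.\<close>

definition between :: "'a::hadamard_space \<Rightarrow> 'a \<Rightarrow> real \<Rightarrow> 'a" where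
  "between a b t = (THE p. p \<in> geod a b ` {0..1} \<and> dist a p = t * dist a b)"

definition geodesic_comb ::
    "(real \<Rightarrow> 'a::hadamard_space) \<Rightarrow> (real \<Rightarrow> 'a) \<Rightarrow> real \<Rightarrow> real \<Rightarrow> 'a" where
  "geodesic_comb \<gamma> \<eta> t = geod (\<gamma> 0) (between (\<gamma> 1) (\<eta> 1) t)"

definition geodesically_convex :: "(real \<Rightarrow> 'a::hadamard_space) set \<Rightarrow> bool" where
  "geodesically_convex S \<longleftrightarrow> (\<forall>\<gamma>\<in>S. \<forall>\<eta>\<in>S. \<forall>t\<in>{0..1}. geodesic_comb \<gamma> \<eta> t \<in> S)"

definition geodesic_proj :: "(real \<Rightarrow> 'a::metric_space) \<Rightarrow> 'a \<Rightarrow> 'a" where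
  "geodesic_proj \<gamma> z =
     (THE p. p \<in> \<gamma> ` {0..1} \<and> (\<forall>q \<in> \<gamma> ` {0..1}. dist z p \<le> dist z q))"

lemma geod_eq:
  assumes "\<gamma> \<in> geodesics a" "\<gamma> 1 = b" shows "geod a b = \<gamma>"
  unfolding geod_def using assms geodesics_unique by blast

lemma geod: "geod a b \<in> geodesics a" "geod a b 1 = b"
  using geodesics_exist[of a b] geod_eq[of _ a b] by metis+

lemma between_eq: assumes "t \<in> {0..1}" shows "between a b t = geod a b t"
proof -
  have g: "geod a b 0 = a" "geod a b 1 = b" using geod[of a b] geodesicsD(2) by blast+
  have d: "dist a (geod a b s) = s * dist a b" if "s \<in> {0..1}" for s
    using geodesicsD(4)[OF geod(1)[of a b] that] g by simp
  have e: "geod a b s = geod a b u" if "s \<in> {0..1}" "u \<in> {0..1}" "s * dist a b = u * dist a b" for s u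
  proof -
    have "dist (geod a b s) (geod a b u) = \<bar>s - u\<bar> * dist a b"
      using geodesicsD(3)[OF geod(1)[of a b] that(1,2)] g by simp
    also have "\<dots> = 0" using that(3) by (auto simp: algebra_simps)
    finally show ?thesis by simp
  qed
  show ?thesis unfolding between_def
  proof (rule the_equality)
    show "geod a b t \<in> geod a b ` {0..1} \<and> dist a (geod a b t) = t * dist a b"
      using assms d by blast
  next
    fix p assume "p \<in> geod a b ` {0..1} \<and> dist a p = t * dist a b"
    then obtain s where s: "s \<in> {0..1}" "p = geod a b s" "dist a p = t * dist a b" by blast
    then show "p = geod a b t" using e[OF s(1) assms] d[OF s(1)] by metis
  qed
qed


section \<open>The metric space of geodesics from a point\<close>

text \<open>The case distinction makes \<open>d1 x\<close> a metric in the sense of the locale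
  \<open>Metric_space\<close>, which demands non-negativity and symmetry also off the carrier, where
  the supremum need not exist.\<close>

definition d1 :: "'a::metric_space \<Rightarrow> (real \<Rightarrow> 'a) \<Rightarrow> (real \<Rightarrow> 'a) \<Rightarrow> real" where
  "d1 x \<gamma> \<eta> = (if \<gamma> \<in> geodesics x \<and> \<eta> \<in> geodesics x
                 then SUP t\<in>{0..1}. dist (\<gamma> t) (\<eta> t) else 0)"

lemma dist_le_d1:
  assumes "\<gamma> \<in> geodesics x" "\<eta> \<in> geodesics x" "t \<in> {0..1}"
  shows "dist (\<gamma> t) (\<eta> t) \<le> d1 x \<gamma> \<eta>"
proof -
  have "dist (\<gamma> s) (\<eta> s) \<le> dist x (\<gamma> 1) + dist x (\<eta> 1)" if "s \<in> {0..1}" for s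
  proof -
    have "dist (\<gamma> s) (\<eta> s) \<le> dist x (\<gamma> s) + dist x (\<eta> s)"
      using dist_triangle3[of "\<gamma> s" "\<eta> s" x] by simp
    also have "\<dots> = s * dist x (\<gamma> 1) + s * dist x (\<eta> 1)"
      using geodesicsD(4) assms that by metis
    also have "\<dots> \<le> 1 * dist x (\<gamma> 1) + 1 * dist x (\<eta> 1)"
      using that by (intro add_mono mult_right_mono) auto
    finally show ?thesis by simp
  qed
  then have "bdd_above ((\<lambda>s. dist (\<gamma> s) (\<eta> s)) ` {0..1})"
    by (rule bdd_aboveI2)
  then show ?thesis
    unfolding d1_def
    using assms cSUP_upper[of t "{0..1}" "\<lambda>s. dist (\<gamma> s) (\<eta> s)"] by (simp only: simp_thms if_True)
qed

lemma Metric_space_geodesics: "Metric_space (geodesics x) (d1 x)"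
proof
  fix \<gamma> \<eta> :: "real \<Rightarrow> 'a"
  show "0 \<le> d1 x \<gamma> \<eta>"
  proof (cases "\<gamma> \<in> geodesics x \<and> \<eta> \<in> geodesics x")
    case True
    then have "dist (\<gamma> 0) (\<eta> 0) \<le> d1 x \<gamma> \<eta>" by (intro dist_le_d1) auto
    then show ?thesis using zero_le_dist[of "\<gamma> 0" "\<eta> 0"] by linarith
  qed (auto simp: d1_def)
  show "d1 x \<gamma> \<eta> = d1 x \<eta> \<gamma>" by (auto simp: d1_def dist_commute)
next
  fix \<gamma> \<eta> :: "real \<Rightarrow> 'a"
  assume g: "\<gamma> \<in> geodesics x" "\<eta> \<in> geodesics x"
  show "d1 x \<gamma> \<eta> = 0 \<longleftrightarrow> \<gamma> = \<eta>"
  proof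
    assume "d1 x \<gamma> \<eta> = 0"
    then have "\<gamma> t = \<eta> t" if "t \<in> {0..1}" for t
      using dist_le_d1[OF g that] by simp
    moreover have "\<gamma> \<in> extensional {0..1}" "\<eta> \<in> extensional {0..1}"
      using g geodesicsD(1) by blast+
    ultimately show "\<gamma> = \<eta>" by (auto intro: extensionalityI)
  qed (use g in \<open>simp add: d1_def\<close>)
next
  fix \<gamma> \<eta> \<zeta> :: "real \<Rightarrow> 'a"
  assume g: "\<gamma> \<in> geodesics x" "\<eta> \<in> geodesics x" "\<zeta> \<in> geodesics x"
  have "dist (\<gamma> t) (\<zeta> t) \<le> d1 x \<gamma> \<eta> + d1 x \<eta> \<zeta>" if "t \<in> {0..1}" for t
    using dist_le_d1[OF g(1,2) that] dist_le_d1[OF g(2,3) that]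
      dist_triangle[of "\<gamma> t" "\<zeta> t" "\<eta> t"] by linarith
  then have "(SUP t\<in>{0..1}. dist (\<gamma> t) (\<zeta> t)) \<le> d1 x \<gamma> \<eta> + d1 x \<eta> \<zeta>"
    by (intro cSUP_least) auto
  then show "d1 x \<gamma> \<zeta> \<le> d1 x \<gamma> \<eta> + d1 x \<eta> \<zeta>"
    using g by (simp add: d1_def[of x \<gamma> \<zeta>])
qed

abbreviation d1_closed :: "'a::metric_space \<Rightarrow> (real \<Rightarrow> 'a) set \<Rightarrow> bool" where
  "d1_closed x \<equiv> closedin (Metric_space.mtopology (geodesics x) (d1 x))"

abbreviation d1_bounded :: "'a::metric_space \<Rightarrow> (real \<Rightarrow> 'a) set \<Rightarrow> bool" where
  "d1_bounded x \<equiv> Metric_space.mbounded (geodesics x) (d1 x)"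


section \<open>Weak convergence and weak topologies\<close>

definition weakly_converges :: "(nat \<Rightarrow> 'a::metric_space) \<Rightarrow> 'a \<Rightarrow> bool" where
  "weakly_converges X y \<longleftrightarrow> (\<forall>\<gamma>\<in>geodesics y. (\<lambda>n. geodesic_proj \<gamma> (X n)) \<longlonglongrightarrow> y)"

definition weakly_Gamma_converges ::
    "(nat \<Rightarrow> real \<Rightarrow> 'a::metric_space) \<Rightarrow> (real \<Rightarrow> 'a) \<Rightarrow> bool" where
  "weakly_Gamma_converges g \<gamma> \<longleftrightarrow> weakly_converges (\<lambda>n. g n 1) (\<gamma> 1)"

definition weakly_Gamma_seq_closed :: "'a::metric_space \<Rightarrow> (real \<Rightarrow> 'a) set \<Rightarrow> bool" where
  "weakly_Gamma_seq_closed x S \<longleftrightarrow>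
     (\<forall>g. \<forall>\<gamma>\<in>geodesics x. range g \<subseteq> S \<and> weakly_Gamma_converges g \<gamma> \<longrightarrow> \<gamma> \<in> S)"

definition weakly_Gamma_seq_compact :: "(real \<Rightarrow> 'a::metric_space) set \<Rightarrow> bool" where
  "weakly_Gamma_seq_compact S \<longleftrightarrow>
     (\<forall>g :: nat \<Rightarrow> real \<Rightarrow> 'a. range g \<subseteq> S \<longrightarrow>
        (\<exists>r. \<exists>\<gamma>\<in>S. strict_mono r \<and> weakly_Gamma_converges (g \<circ> r) \<gamma>))"

text \<open>The sets \<open>{z. d(y, P z) < \<epsilon>}\<close>, for finitely many projections \<open>P\<close> onto
  geodesics starting at \<open>y\<close>.\<close>

definition weak_nbhd :: "'a::metric_space \<Rightarrow> real \<Rightarrow> (real \<Rightarrow> 'a) set \<Rightarrow> 'a set" where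
  "weak_nbhd y \<epsilon> F = {z. \<forall>\<gamma>\<in>F. dist y (geodesic_proj \<gamma> z) < \<epsilon>}"

lemma weak_nbhd_Int:
  "weak_nbhd y (min \<delta> \<epsilon>) (F \<union> G) \<subseteq> weak_nbhd y \<delta> F \<inter> weak_nbhd y \<epsilon> G"
  by (auto simp: weak_nbhd_def)

text \<open>Allowing \<open>F\<close> to be empty changes nothing, since the projection onto a constant
  geodesic is constant.\<close>

definition weakly_open :: "'a::metric_space set \<Rightarrow> bool" where
  "weakly_open U \<longleftrightarrow>
     (\<forall>y\<in>U. \<exists>\<epsilon>>0. \<exists>F. finite F \<and> F \<subseteq> geodesics y \<and> weak_nbhd y \<epsilon> F \<subseteq> U)"

definition weak_topology :: "'a::metric_space topology" where
  "weak_topology = topology weakly_open"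

definition weakly_proper :: "'a::metric_space itself \<Rightarrow> bool" where
  "weakly_proper TYPE('a) \<longleftrightarrow>
     (\<forall>(y::'a). \<forall>\<gamma>\<in>geodesics y. \<forall>\<epsilon>>0. \<exists>V.
        openin weak_topology V \<and> y \<in> V \<and> V \<subseteq> {z. dist y (geodesic_proj \<gamma> z) < \<epsilon>})"

definition weakly_Gamma_open :: "'a::metric_space \<Rightarrow> (real \<Rightarrow> 'a) set \<Rightarrow> bool" where
  "weakly_Gamma_open x U \<longleftrightarrow> U \<subseteq> geodesics x \<and>
     (\<forall>\<gamma>\<in>U. \<exists>\<epsilon>>0. \<exists>F. finite F \<and> F \<subseteq> geodesics (\<gamma> 1) \<and>
        {\<eta> \<in> geodesics x. \<eta> 1 \<in> weak_nbhd (\<gamma> 1) \<epsilon> F} \<subseteq> U)"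

definition weak_Gamma_topology :: "'a::metric_space \<Rightarrow> (real \<Rightarrow> 'a) topology" where
  "weak_Gamma_topology x = topology (weakly_Gamma_open x)"

lemma openin_weak_topology: "openin weak_topology = weakly_open"
proof -
  have "istopology (weakly_open :: 'a set \<Rightarrow> bool)"
    unfolding istopology_def
  proof (intro conjI allI impI)
    fix S T :: "'a set" assume S: "weakly_open S" and T: "weakly_open T"
    show "weakly_open (S \<inter> T)"
      unfolding weakly_open_def
    proof
      fix y assume y: "y \<in> S \<inter> T"
      obtain \<delta> F where 1: "\<delta> > 0" "finite F" "F \<subseteq> geodesics y" "weak_nbhd y \<delta> F \<subseteq> S"
        using S y unfolding weakly_open_def by blast
      obtain \<epsilon> G where 2: "\<epsilon> > 0" "finite G" "G \<subseteq> geodesics y" "weak_nbhd y \<epsilon> G \<subseteq> T"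
        using T y unfolding weakly_open_def by blast
      show "\<exists>\<epsilon>>0. \<exists>F. finite F \<and> F \<subseteq> geodesics y \<and> weak_nbhd y \<epsilon> F \<subseteq> S \<inter> T"
        using 1 2 weak_nbhd_Int[of y \<delta> \<epsilon> F G]
        by (intro exI[of _ "min \<delta> \<epsilon>"] conjI exI[of _ "F \<union> G"]) auto
    qed
  next
    fix K :: "'a set set" assume "\<forall>U\<in>K. weakly_open U"
    then show "weakly_open (\<Union>K)" unfolding weakly_open_def by (meson Union_iff Union_upper order_trans)
  qed
  then show ?thesis unfolding weak_topology_def by (rule topology_inverse')
qed

lemma openin_weak_Gamma_topology: "openin (weak_Gamma_topology x) = weakly_Gamma_open x"
proof -
  have "istopology (weakly_Gamma_open x)"
    unfolding istopology_def
  proof (intro conjI allI impI)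
    fix S T assume S: "weakly_Gamma_open x S" and T: "weakly_Gamma_open x T"
    show "weakly_Gamma_open x (S \<inter> T)"
      unfolding weakly_Gamma_open_def
    proof (intro conjI ballI)
      show "S \<inter> T \<subseteq> geodesics x" using S by (auto simp: weakly_Gamma_open_def)
    next
      fix \<gamma> assume y: "\<gamma> \<in> S \<inter> T"
      obtain \<delta> F where 1: "\<delta> > 0" "finite F" "F \<subseteq> geodesics (\<gamma> 1)"
          "{\<eta> \<in> geodesics x. \<eta> 1 \<in> weak_nbhd (\<gamma> 1) \<delta> F} \<subseteq> S"
        using S y unfolding weakly_Gamma_open_def by blast
      obtain \<epsilon> G where 2: "\<epsilon> > 0" "finite G" "G \<subseteq> geodesics (\<gamma> 1)"
          "{\<eta> \<in> geodesics x. \<eta> 1 \<in> weak_nbhd (\<gamma> 1) \<epsilon> G} \<subseteq> T"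
        using T y unfolding weakly_Gamma_open_def by blast
      show "\<exists>\<epsilon>>0. \<exists>F. finite F \<and> F \<subseteq> geodesics (\<gamma> 1) \<and>
          {\<eta> \<in> geodesics x. \<eta> 1 \<in> weak_nbhd (\<gamma> 1) \<epsilon> F} \<subseteq> S \<inter> T"
        using 1 2 weak_nbhd_Int[of "\<gamma> 1" \<delta> \<epsilon> F G]
        by (intro exI[of _ "min \<delta> \<epsilon>"] conjI exI[of _ "F \<union> G"]) auto
    qed
  next
    fix K assume "\<forall>U\<in>K. weakly_Gamma_open x U"
    then show "weakly_Gamma_open x (\<Union>K)"
      unfolding weakly_Gamma_open_def by (meson Sup_least Union_iff Union_upper order_trans)
  qed
  then show ?thesis unfolding weak_Gamma_topology_def by (rule topology_inverse')
qed

lemma topspace_weak_Gamma_topology: "topspace (weak_Gamma_topology x) = geodesics x"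
proof -
  have "weakly_Gamma_open x (geodesics x)"
    unfolding weakly_Gamma_open_def by (auto intro!: exI[of _ "1::real"] exI[of _ "{}"])
  then have "openin (weak_Gamma_topology x) (geodesics x)"
    by (simp add: openin_weak_Gamma_topology)
  moreover have "topspace (weak_Gamma_topology x) \<subseteq> geodesics x"
    using openin_topspace[of "weak_Gamma_topology x"]
    unfolding openin_weak_Gamma_topology weakly_Gamma_open_def by blast
  ultimately show ?thesis using openin_subset by blast
qed

end

theory Submission
  imports Defs "HOL-Complex_Analysis.Great_Picard"
begin

text \<open>A geodesic starting at \<open>x\<close> is determined by its endpoint, and the CAT(0) inequality shows
that sending a geodesic to its endpoint is an isometry for \<open>d1 x\<close>. It also carries the
weak-Gamma notions to the weak ones of the space and convex sets to sets closed under midpoints.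
So everything is decided in the Hadamard space itself.

The analytic tool is \<open>minimizer_exists\<close>: a nonnegative continuous function that is uniformly convex
in the sense of the CAT(0) inequality has a minimiser on each nonempty closed set closed under
midpoints, and it exceeds its minimum by at least the squared distance to the minimiser. Applied
to the squared distance to a point it yields metric projections.

For the subsequence property, the separable closed hull of a bounded sequence is considered. A
diagonal argument gives a subsequence whose distances to all points of the hull converge, and the
minimiser of the squared limit distance, the asymptotic centre, is the weak limit
(\<open>bounded_weakly_convergent_subsequence\<close>).

A closed convex set contains the weak limits \<open>y\<close> of its sequences, because all of its points
have the same projection to the segment from \<open>y\<close> to the nearest point of the set, namely that
nearest point (\<open>weakly_converges_closed_midconvex\<close>). With the subsequence property this
gives sequential compactness in the bounded case.

Compactness follows from sequential compactness once covers can be made countable. This is where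
separability enters: weakly open sets are open for the metric, and a separable metric space is
Lindelof (\<open>weakly_open_cover_finite_subcover\<close>).

Finally, two points are separated by projecting to the segment that joins them and comparing
with the two halves of the segment; weak properness says precisely that such conditions on
projections contain weakly open neighbourhoods (\<open>weakly_proper_separation\<close>).\<close>

section \<open>Comparison triangles and the CAT(0) inequality\<close>

lemma comparison_triangle_exists:
  fixes p q l :: real
  assumes "p \<le> l + q" "q \<le> l + p" "l \<le> p + q"
  shows "\<exists>a b c :: real^2. dist a b = l \<and> dist b c = q \<and> dist c a = p"
proof -
  \<comment> \<open>The vertices are \<open>(0,0)\<close>, \<open>(l,0)\<close> and \<open>(u,v)\<close>, with \<open>u\<close> given by
    the law of cosines. If \<open>l = 0\<close>, then \<open>p = q\<close>, and division by zero yields the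
    admissible value \<open>u = 0\<close>.\<close>
  define u where "u = (p\<^sup>2 + l\<^sup>2 - q\<^sup>2) / (2 * l)"
  define v where "v = sqrt (p\<^sup>2 - u\<^sup>2)"
  have l: "l \<ge> 0" "p \<ge> 0" "q \<ge> 0" using assms by linarith+
  have lu: "2 * l * u = p\<^sup>2 + l\<^sup>2 - q\<^sup>2"
    using assms by (cases "l = 0") (auto simp: u_def)
  have "\<bar>u\<bar> \<le> p"
  proof (cases "l = 0")
    case False
    have "q\<^sup>2 \<le> (l + p)\<^sup>2" by (rule power_mono) (use assms l in auto)
    moreover have "(p - l)\<^sup>2 \<le> q\<^sup>2"
      using assms l unfolding abs_le_square_iff[symmetric] by auto
    ultimately
    have "2 * l * u \<le> 2 * l * p" "2 * l * (- p) \<le> 2 * l * u"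
      unfolding lu by (simp_all add: power2_eq_square algebra_simps)
    then have "u \<le> p" "- p \<le> u"
      using False l mult_le_cancel_left_pos[of "2 * l" u p]
        mult_le_cancel_left_pos[of "2 * l" "- p" u] by linarith+
    then show ?thesis by simp
  qed (use l in \<open>simp add: u_def\<close>)
  then have "u\<^sup>2 \<le> p\<^sup>2" using l by (simp add: abs_le_square_iff[symmetric])
  then have v: "u\<^sup>2 + v\<^sup>2 = p\<^sup>2" by (simp add: v_def)
  have "(u - l)\<^sup>2 + v\<^sup>2 = q\<^sup>2"
    using lu v by (simp add: power2_eq_square algebra_simps)
  moreover have "dist x y = sqrt ((x$1 - y$1)\<^sup>2 + (x$2 - y$2)\<^sup>2)" for x y :: "real^2"
    by (simp add: dist_vec_def L2_set_def sum_2 dist_real_def)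
  ultimately show ?thesis
    using v l
    by (intro exI[of _ "vector [0,0]"] exI[of _ "vector [l,0]"] exI[of _ "vector [u,v]"])
       (simp add: power2_commute[of l])
qed

lemma stewart:
  fixes a b c :: "'e::real_inner"
  shows "(dist ((1 - t) *\<^sub>R a + t *\<^sub>R b) c)\<^sup>2 =
         (1 - t) * (dist c a)\<^sup>2 + t * (dist c b)\<^sup>2 - t * (1 - t) * (dist a b)\<^sup>2"
proof -
  have "a \<bullet> b = b \<bullet> a" "a \<bullet> c = c \<bullet> a" "b \<bullet> c = c \<bullet> b" by (simp_all add: inner_commute)
  then show ?thesis
    unfolding dist_norm power2_norm_eq_inner
    by (simp add: inner_diff_left inner_diff_right inner_add_left inner_add_right)
       (simp add: algebra_simps)
qed

text \<open>The triangle comparison, with the third vertex as second comparison point, bounds the left-hand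
side by its Euclidean counterpart, which Stewart's identity evaluates. The arguments
below use the triangle comparison only through this inequality and the uniqueness of geodesics.\<close>

lemma cat0_inequality:
  fixes z :: "'a::hadamard_space"
  assumes g: "\<gamma> \<in> geodesics a" and t: "t \<in> {0..1}"
  shows "(dist z (\<gamma> t))\<^sup>2 \<le>
         (1 - t) * (dist z a)\<^sup>2 + t * (dist z (\<gamma> 1))\<^sup>2 - t * (1 - t) * (dist a (\<gamma> 1))\<^sup>2"
proof -
  let ?b = "\<gamma> 1"
  obtain a' b' z' :: "real^2"
    where d: "dist a' b' = dist a ?b" "dist b' z' = dist ?b z" "dist z' a' = dist z a"
    using comparison_triangle_exists[of "dist z a" "dist a ?b" "dist ?b z"]
      dist_triangle[of z a ?b] dist_triangle[of ?b z a] dist_triangle[of a ?b z]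
    by (metis add.commute dist_commute)
  have "dist (\<gamma> t) (geod ?b z 1) \<le>
        dist ((1 - t) *\<^sub>R a' + t *\<^sub>R b') ((1 - 1) *\<^sub>R b' + 1 *\<^sub>R z')"
    by (rule triangle_comparison[OF g refl geod(1) geod(2) geod(1) geod(2) d t]) simp
  then have "dist z (\<gamma> t) \<le> dist ((1 - t) *\<^sub>R a' + t *\<^sub>R b') z'"
    by (simp add: geod dist_commute)
  then have "(dist z (\<gamma> t))\<^sup>2 \<le> (dist ((1 - t) *\<^sub>R a' + t *\<^sub>R b') z')\<^sup>2"
    by (rule power_mono) simp
  then show ?thesis unfolding stewart using d by (simp add: dist_commute)
qed

section \<open>Midpoints, subgeodesics and geodesics with a common start\<close>

definition midpt :: "'a::hadamard_space \<Rightarrow> 'a \<Rightarrow> 'a" where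
  "midpt a b = geod a b (1/2)"

lemma midpt_inequality:
  "(dist z (midpt a b))\<^sup>2 \<le> (dist z a)\<^sup>2 / 2 + (dist z b)\<^sup>2 / 2 - (dist a b)\<^sup>2 / 4"
  using cat0_inequality[OF geod(1)[of a b], of "1/2" z] by (simp add: midpt_def geod)

lemma dist_midpt:
  "dist a (midpt a b) = dist a b / 2" "dist b (midpt a b) = dist a b / 2"
  using geodesicsD(4)[OF geod(1)[of a b], of "1/2"]
    geodesicsD(3)[OF geod(1)[of a b], of 1 "1/2"] by (simp_all add: midpt_def geod)

lemma subgeodesic:
  assumes g: "\<gamma> \<in> geodesics y" and s: "s \<in> {0..1}" and u: "u \<in> {0..1}"
  shows "restrict (\<lambda>t. \<gamma> ((1 - t) * s + t * u)) {0..1} \<in> geodesics (\<gamma> s)"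
proof -
  have m: "(1 - t) * s + t * u \<in> {0..1}" if "t \<in> {0..1}" for t
    using that s u convexD[OF convex_real_interval(5)[of 0 1], of s u "1 - t" t] by simp
  have "dist (\<gamma> ((1 - t) * s + t * u)) (\<gamma> ((1 - r) * s + r * u)) = \<bar>t - r\<bar> * dist (\<gamma> s) (\<gamma> u)"
    if "t \<in> {0..1}" "r \<in> {0..1}" for t r
  proof -
    have "((1 - t) * s + t * u) - ((1 - r) * s + r * u) = (r - t) * (s - u)"
      by (simp add: algebra_simps)
    then show ?thesis
      using geodesicsD(3)[OF g m[OF that(1)] m[OF that(2)]] geodesicsD(3)[OF g s u]
      by (simp add: abs_mult abs_minus_commute)
  qed
  then show ?thesis by (simp add: geodesics_def)
qed

lemma midpt_on_geodesic:
  fixes y :: "'a::hadamard_space"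
  assumes "\<gamma> \<in> geodesics y" "s \<in> {0..1}" "u \<in> {0..1}"
  shows "midpt (\<gamma> s) (\<gamma> u) = \<gamma> ((s + u) / 2)"
  using geod_eq[OF subgeodesic[OF assms]] by (simp add: midpt_def add_divide_distrib)

text \<open>Two applications of the CAT(0) inequality, to \<open>\<eta>\<close> seen from \<open>\<gamma> t\<close> and to
\<open>\<gamma>\<close> seen from \<open>\<eta> 1\<close>: the terms with the lengths of the geodesics cancel.\<close>

lemma dist_geodesics_le:
  fixes x :: "'a::hadamard_space"
  assumes g: "\<gamma> \<in> geodesics x" and h: "\<eta> \<in> geodesics x" and t: "t \<in> {0..1}"
  shows "dist (\<gamma> t) (\<eta> t) \<le> t * dist (\<gamma> 1) (\<eta> 1)"
proof -
  define A B where "A = (dist x (\<gamma> 1))\<^sup>2" and "B = (dist x (\<eta> 1))\<^sup>2"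
  have 1: "(dist (\<gamma> t) (\<eta> t))\<^sup>2 \<le> (1 - t) * (t\<^sup>2 * A) + t * (dist (\<gamma> t) (\<eta> 1))\<^sup>2 - t * (1 - t) * B"
    using cat0_inequality[OF h t, of "\<gamma> t"] geodesicsD(4)[OF g t]
    by (simp add: A_def B_def dist_commute power_mult_distrib)
  have "(dist (\<gamma> t) (\<eta> 1))\<^sup>2 \<le> (1 - t) * B + t * (dist (\<gamma> 1) (\<eta> 1))\<^sup>2 - t * (1 - t) * A"
    using cat0_inequality[OF g t, of "\<eta> 1"] by (simp add: A_def B_def dist_commute)
  then have "t * (dist (\<gamma> t) (\<eta> 1))\<^sup>2 \<le> t * ((1 - t) * B + t * (dist (\<gamma> 1) (\<eta> 1))\<^sup>2 - t * (1 - t) * A)"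
    using t by (intro mult_left_mono) auto
  with 1 have "(dist (\<gamma> t) (\<eta> t))\<^sup>2 \<le> (t * dist (\<gamma> 1) (\<eta> 1))\<^sup>2"
    by (simp add: power2_eq_square algebra_simps)
  then show ?thesis by (rule power2_le_imp_le) (use t in auto)
qed

section \<open>Minimisers of uniformly convex functions and metric projections\<close>

text \<open>For closed sets, closure under midpoints amounts to convexity. Unlike closure under whole geodesic
segments, it can be achieved within countable sets, as the separable hull of a sequence requires.\<close>

definition midconvex :: "'a::hadamard_space set \<Rightarrow> bool" where
  "midconvex C \<longleftrightarrow> (\<forall>a\<in>C. \<forall>b\<in>C. midpt a b \<in> C)"

text \<open>Completeness replaces compactness: by the midpoint hypothesis, two points whose values are close
to the infimum are close to each other, so every minimising sequence is Cauchy. Metric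
projections and asymptotic centres are both obtained from this lemma.

A single midpoint would give the last inequality only with half of the squared distance; the full
square, obtained by moving towards \<open>p\<close> through repeated halving, is essential for the
criterion of weak convergence below.\<close>

lemma minimizer_exists:
  fixes C :: "'a::hadamard_space set" and G :: "'a \<Rightarrow> real"
  assumes C: "closed C" "C \<noteq> {}" "midconvex C"
    and cont: "continuous_on C G" and pos: "\<And>c. c \<in> C \<Longrightarrow> G c \<ge> 0"
    and mid: "\<And>a b. a \<in> C \<Longrightarrow> b \<in> C \<Longrightarrow> G (midpt a b) \<le> G a / 2 + G b / 2 - (dist a b)\<^sup>2 / 4"
  obtains p where "p \<in> C" "\<And>c. c \<in> C \<Longrightarrow> G p + (dist p c)\<^sup>2 \<le> G c"
proof -
  define I where "I = Inf (G ` C)"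
  have I: "I \<le> G c" if "c \<in> C" for c
    unfolding I_def using that pos by (intro cInf_lower) (auto intro!: bdd_belowI2[of _ 0])
  have "\<exists>c\<in>C. G c < I + 1 / real (Suc n)" for n
    using cInf_lessD[of "G ` C" "I + 1 / real (Suc n)"] C(2) by (auto simp: I_def)
  then obtain c where c: "\<And>n. c n \<in> C" "\<And>n. G (c n) < I + 1 / real (Suc n)" by metis
  have "Cauchy c"
  proof (rule metric_CauchyI)
    fix e :: real assume e: "e > 0"
    obtain N where N: "1 / real (Suc N) < e\<^sup>2 / 4"
      using nat_approx_posE[of "e\<^sup>2 / 4"] e by (metis zero_less_divide_iff zero_less_numeral zero_less_power)
    show "\<exists>M. \<forall>m\<ge>M. \<forall>n\<ge>M. dist (c m) (c n) < e"
    proof (intro exI[of _ N] allI impI)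
      fix m n assume mn: "N \<le> m" "N \<le> n"
      have "1 / real (Suc m) \<le> 1 / real (Suc N)" "1 / real (Suc n) \<le> 1 / real (Suc N)"
        using mn by (auto intro!: divide_left_mono)
      moreover have "I \<le> G (midpt (c m) (c n))"
        using c(1) C(3) I by (auto simp: midconvex_def)
      ultimately have "(dist (c m) (c n))\<^sup>2 < e\<^sup>2"
        using N c(2)[of m] c(2)[of n] mid[OF c(1)[of m] c(1)[of n]] by linarith
      then show "dist (c m) (c n) < e" using e power2_less_imp_less by fastforce
    qed
  qed
  then obtain p where p: "c \<longlonglongrightarrow> p" using Cauchy_convergent_iff convergent_def by blast
  have pC: "p \<in> C" using closed_sequentially[OF C(1) c(1) p] .
  have "(\<lambda>n. G (c n)) \<longlonglongrightarrow> G p"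
    using continuous_on_tendsto_compose[OF cont p pC] c(1) by simp
  moreover have "(\<lambda>n. I + 1 / real (Suc n)) \<longlonglongrightarrow> I + 0"
    by (intro tendsto_intros LIMSEQ_Suc lim_1_over_n)
  ultimately have "G p \<le> I + 0"
    by (rule LIMSEQ_le) (use c(2) less_imp_le in blast)
  then have min: "G p \<le> G b" if "b \<in> C" for b using I[OF that] by simp
  \<comment> \<open>Applying the bound for \<open>k\<close> to the midpoint of \<open>p\<close> and \<open>b\<close> halves the
    defect of the coefficient from 1.\<close>
  have approx: "G p + (1 - (1/2) ^ k) * (dist p b)\<^sup>2 \<le> G b" if "b \<in> C" for b k
    using that
  proof (induction k arbitrary: b)
    case 0
    then show ?case using min by simp
  next
    case (Suc k)
    let ?m = "midpt p b"
    have "?m \<in> C" using Suc.prems pC C(3) by (auto simp: midconvex_def)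
    then have "G p + (1 - (1/2) ^ k) * (dist p ?m)\<^sup>2 \<le> G ?m" by (rule Suc.IH)
    then have "G p + ((dist p b)\<^sup>2 - (1/2) ^ k * (dist p b)\<^sup>2) / 4 \<le> G ?m"
      by (simp add: dist_midpt power_divide left_diff_distrib)
    then have "G p + ((dist p b)\<^sup>2 - (1/2) ^ k * (dist p b)\<^sup>2 / 2) \<le> G b"
      using mid[OF pC Suc.prems] by argo
    then show ?case by (simp add: left_diff_distrib)
  qed
  show ?thesis
  proof (rule that[OF pC])
    fix b assume "b \<in> C"
    have "(\<lambda>k. G p + (1 - (1/2) ^ k) * (dist p b)\<^sup>2) \<longlonglongrightarrow> G p + (1 - 0) * (dist p b)\<^sup>2"
      by (intro tendsto_intros LIMSEQ_power_zero) auto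
    then show "G p + (dist p b)\<^sup>2 \<le> G b"
      using LIMSEQ_le_const2 approx[OF \<open>b \<in> C\<close>] by fastforce
  qed
qed

lemma projection_exists:
  fixes C :: "'a::hadamard_space set"
  assumes "closed C" "C \<noteq> {}" "midconvex C"
  obtains p where "p \<in> C" "\<And>c. c \<in> C \<Longrightarrow> (dist z p)\<^sup>2 + (dist p c)\<^sup>2 \<le> (dist z c)\<^sup>2"
proof (rule minimizer_exists[OF assms, of "\<lambda>c. (dist z c)\<^sup>2"])
  show "continuous_on C (\<lambda>c. (dist z c)\<^sup>2)" by (intro continuous_intros)
qed (use midpt_inequality that in auto)

lemma geodesic_continuous:
  assumes g: "\<gamma> \<in> geodesics y" shows "continuous_on {0..1} \<gamma>"
proof -
  have "dist (\<gamma> s) (\<gamma> t) \<le> dist y (\<gamma> 1) * dist s t" if "s \<in> {0..1}" "t \<in> {0..1}" for s t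
    using geodesicsD(3)[OF g that] by (simp add: dist_real_def mult.commute)
  then have "(dist y (\<gamma> 1))-lipschitz_on {0..1} \<gamma>" by (intro lipschitz_onI) auto
  then show ?thesis by (rule lipschitz_on_continuous_on)
qed

lemma midconvex_geodesic:
  fixes y :: "'a::hadamard_space"
  assumes g: "\<gamma> \<in> geodesics y" shows "midconvex (\<gamma> ` {0..1})"
  using midpt_on_geodesic[OF g] by (auto simp: midconvex_def)

text \<open>The image of a geodesic is compact and closed under midpoints, so the description defining
\<open>geodesic_proj\<close> singles out a point.\<close>

lemma geodesic_proj:
  fixes y :: "'a::hadamard_space"
  assumes g: "\<gamma> \<in> geodesics y"
  shows "geodesic_proj \<gamma> z \<in> \<gamma> ` {0..1}"
    and "q \<in> \<gamma> ` {0..1} \<Longrightarrow> (dist z (geodesic_proj \<gamma> z))\<^sup>2 + (dist (geodesic_proj \<gamma> z) q)\<^sup>2 \<le> (dist z q)\<^sup>2"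
proof -
  have "closed (\<gamma> ` {0..1})"
    using geodesic_continuous[OF g] by (intro compact_imp_closed compact_continuous_image) auto
  then obtain p where p: "p \<in> \<gamma> ` {0..1}"
    "\<And>c. c \<in> \<gamma> ` {0..1} \<Longrightarrow> (dist z p)\<^sup>2 + (dist p c)\<^sup>2 \<le> (dist z c)\<^sup>2"
    using projection_exists[of "\<gamma> ` {0..1}"] midconvex_geodesic[OF g] by auto
  have "geodesic_proj \<gamma> z = p"
    unfolding geodesic_proj_def
  proof (rule the_equality)
    have "dist z p \<le> dist z c" if "c \<in> \<gamma> ` {0..1}" for c
    proof (rule power2_le_imp_le)
      show "(dist z p)\<^sup>2 \<le> (dist z c)\<^sup>2"
        using p(2)[OF that] zero_le_power2[of "dist p c"] by linarith
    qed simp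
    then show "p \<in> \<gamma> ` {0..1} \<and> (\<forall>q\<in>\<gamma> ` {0..1}. dist z p \<le> dist z q)" using p(1) by blast
  next
    fix q assume q: "q \<in> \<gamma> ` {0..1} \<and> (\<forall>r\<in>\<gamma> ` {0..1}. dist z q \<le> dist z r)"
    then have "(dist z q)\<^sup>2 \<le> (dist z p)\<^sup>2" using p(1) by (auto intro!: power_mono)
    then have "(dist p q)\<^sup>2 \<le> 0" using p(2)[of q] q by linarith
    then show "q = p" by simp
  qed
  with p show "geodesic_proj \<gamma> z \<in> \<gamma> ` {0..1}"
    "q \<in> \<gamma> ` {0..1} \<Longrightarrow> (dist z (geodesic_proj \<gamma> z))\<^sup>2 + (dist (geodesic_proj \<gamma> z) q)\<^sup>2 \<le> (dist z q)\<^sup>2"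
    by auto
qed

lemma geodesic_proj_le:
  fixes y :: "'a::hadamard_space"
  assumes g: "\<gamma> \<in> geodesics y" and q: "q \<in> \<gamma> ` {0..1}"
  shows "dist z (geodesic_proj \<gamma> z) \<le> dist z q"
proof (rule power2_le_imp_le)
  show "(dist z (geodesic_proj \<gamma> z))\<^sup>2 \<le> (dist z q)\<^sup>2"
    using geodesic_proj(2)[OF g q, of z] zero_le_power2[of "dist (geodesic_proj \<gamma> z) q"] by linarith
qed simp

lemma geodesic_proj_eqI:
  fixes y :: "'a::hadamard_space"
  assumes g: "\<gamma> \<in> geodesics y" and p: "p \<in> \<gamma> ` {0..1}"
    and min: "\<And>q. q \<in> \<gamma> ` {0..1} \<Longrightarrow> dist z p \<le> dist z q"
  shows "geodesic_proj \<gamma> z = p"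
proof -
  have "(dist z p)\<^sup>2 \<le> (dist z (geodesic_proj \<gamma> z))\<^sup>2"
    using min[OF geodesic_proj(1)[OF g]] by (rule power_mono) simp
  then have "(dist (geodesic_proj \<gamma> z) p)\<^sup>2 \<le> 0" using geodesic_proj(2)[OF g p, of z] by linarith
  then show ?thesis by simp
qed


text \<open>The distance to \<open>z\<close> is convex along \<open>\<gamma>\<close> and smallest at the projection. If the
projection lay at or beyond \<open>\<gamma> s\<close>, then \<open>\<gamma> s\<close> would be a point between
\<open>y\<close> and the projection, both at distance at most \<open>dist z y\<close> from \<open>z\<close>.\<close>

lemma geodesic_proj_near_start:
  fixes y :: "'a::hadamard_space"
  assumes g: "\<gamma> \<in> geodesics y" and s: "s \<in> {0..1}" and far: "dist z y < dist z (\<gamma> s)"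
  shows "dist (geodesic_proj \<gamma> z) y < dist (\<gamma> s) y"
proof -
  obtain u where u: "u \<in> {0..1}" "geodesic_proj \<gamma> z = \<gamma> u"
    using geodesic_proj(1)[OF g, of z] by auto
  have y: "\<gamma> 0 = y" using geodesicsD(2)[OF g] .
  have "u < s"
  proof (rule ccontr)
    assume "\<not> u < s"
    moreover have "s \<noteq> 0" using far y by auto
    ultimately have us: "0 < u" "s / u \<in> {0..1}" using s u by auto
    have sub: "restrict (\<lambda>t. \<gamma> ((1 - t) * 0 + t * u)) {0..1} \<in> geodesics y"
      using subgeodesic[OF g, of 0 u] u y by simp
    have "(dist z (\<gamma> s))\<^sup>2 \<le> (1 - s / u) * (dist z y)\<^sup>2 + s / u * (dist z (\<gamma> u))\<^sup>2
        - s / u * (1 - s / u) * (dist y (\<gamma> u))\<^sup>2"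
      using cat0_inequality[OF sub us(2), of z] us by simp
    also have "\<dots> \<le> (1 - s / u) * (dist z y)\<^sup>2 + s / u * (dist z y)\<^sup>2 - 0"
    proof (intro diff_mono add_mono mult_left_mono power_mono order_refl)
      show "dist z (\<gamma> u) \<le> dist z y"
        using geodesic_proj_le[OF g, of y z] y unfolding u(2) by force
      show "0 \<le> s / u * (1 - s / u) * (dist y (\<gamma> u))\<^sup>2"
        using us(2) by (intro mult_nonneg_nonneg) auto
    qed (use us in auto)
    also have "\<dots> = (dist z y)\<^sup>2" by (simp add: algebra_simps)
    finally show False using far power2_le_imp_le[of "dist z (\<gamma> s)" "dist z y"] by simp
  qed
  moreover have "y \<noteq> \<gamma> 1"
  proof
    assume "y = \<gamma> 1"
    then have "\<gamma> s = y" using geodesicsD(4)[OF g s] by simp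
    then show False using far by simp
  qed
  ultimately have "u * dist y (\<gamma> 1) < s * dist y (\<gamma> 1)"
    by (intro mult_strict_right_mono) auto
  then show ?thesis
    using geodesicsD(4)[OF g s] geodesicsD(4)[OF g u(1)] u(2) by (simp add: dist_commute)
qed

section \<open>Separable hulls\<close>

text \<open>The CAT(0) inequality bounds the squared distance between the two midpoints by a continuous
expression that vanishes in the limit.\<close>

lemma tendsto_midpt:
  fixes a b :: "'a::hadamard_space"
  assumes "f \<longlonglongrightarrow> a" "g \<longlonglongrightarrow> b"
  shows "(\<lambda>n. midpt (f n) (g n)) \<longlonglongrightarrow> midpt a b"
proof -
  let ?m = "midpt a b"
  have "(\<lambda>n. (dist ?m (f n))\<^sup>2 / 2 + (dist ?m (g n))\<^sup>2 / 2 - (dist (f n) (g n))\<^sup>2 / 4)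
      \<longlonglongrightarrow> (dist ?m a)\<^sup>2 / 2 + (dist ?m b)\<^sup>2 / 2 - (dist a b)\<^sup>2 / 4"
    by (intro tendsto_intros assms) simp_all
  moreover have "dist ?m a = dist a b / 2" "dist ?m b = dist a b / 2"
    using dist_midpt by (metis dist_commute)+
  ultimately have bound: "(\<lambda>n. (dist ?m (f n))\<^sup>2 / 2 + (dist ?m (g n))\<^sup>2 / 2 - (dist (f n) (g n))\<^sup>2 / 4)
      \<longlonglongrightarrow> 0"
    by (simp add: power_divide)
  have "(\<lambda>n. (dist ?m (midpt (f n) (g n)))\<^sup>2) \<longlonglongrightarrow> 0"
    by (rule tendsto_sandwich[OF eventuallyI eventuallyI tendsto_const bound])
       (rule zero_le_power2 midpt_inequality)+
  then have "(\<lambda>n. sqrt ((dist ?m (midpt (f n) (g n)))\<^sup>2)) \<longlonglongrightarrow> sqrt 0" by (rule tendsto_real_sqrt)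
  then show ?thesis unfolding tendsto_dist_iff[of _ ?m] dist_commute[of _ ?m] by simp
qed

lemma midconvex_closure:
  assumes "midconvex C" shows "midconvex (closure C)"
  unfolding midconvex_def
proof (intro ballI)
  fix a b assume a: "a \<in> closure C" and b: "b \<in> closure C"
  obtain f where f: "\<forall>n. f n \<in> C" "f \<longlonglongrightarrow> a" using a unfolding closure_sequential by blast
  obtain g where g: "\<forall>n. g n \<in> C" "g \<longlonglongrightarrow> b" using b unfolding closure_sequential by blast
  have "\<forall>n. midpt (f n) (g n) \<in> C" using assms f(1) g(1) by (simp add: midconvex_def)
  then show "midpt a b \<in> closure C"
    using tendsto_midpt[OF f(2) g(2)] closure_sequential by metis
qed

primrec midpt_iter :: "'a::hadamard_space set \<Rightarrow> nat \<Rightarrow> 'a set" where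
  "midpt_iter A 0 = A"
| "midpt_iter A (Suc n) = midpt_iter A n \<union> (\<Union>a\<in>midpt_iter A n. midpt a ` midpt_iter A n)"

text \<open>This keeps the extraction of subsequences countable even in a space that is not separable: the
closed hull of a sequence has a countable dense subset.\<close>

lemma countable_midconvex_hull:
  assumes "countable A"
  obtains D where "countable D" "A \<subseteq> D" "midconvex D"
proof
  let ?D = "\<Union>n. midpt_iter A n"
  have "countable (midpt_iter A n)" for n by (induction n) (use assms in auto)
  then show "countable ?D" by (intro countable_UN) auto
  show "A \<subseteq> ?D" using UN_upper[of 0 UNIV "midpt_iter A"] by simp
  have mono: "midpt_iter A m \<subseteq> midpt_iter A n" if "m \<le> n" for m n
    using lift_Suc_mono_le[of "midpt_iter A", OF _ that] by simp
  show "midconvex ?D"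
    unfolding midconvex_def
  proof clarify
    fix a b m n assume "a \<in> midpt_iter A m" "b \<in> midpt_iter A n"
    then have "a \<in> midpt_iter A (max m n)" "b \<in> midpt_iter A (max m n)"
      using mono[of m "max m n"] mono[of n "max m n"] by auto
    then have "midpt a b \<in> midpt_iter A (Suc (max m n))" by auto
    then show "midpt a b \<in> ?D" by blast
  qed
qed

section \<open>Weakly convergent subsequences of bounded sequences\<close>

text \<open>The limit \<open>y\<close> is the asymptotic centre of the sequence in \<open>C\<close>. Let \<open>w\<close> be the
point of a geodesic \<open>\<gamma>\<close> from \<open>y\<close> at distance \<open>e\<close> from \<open>y\<close>. In
squared distance, its projection \<open>q\<close> to \<open>C\<close> is closer to the sequence than
\<open>w\<close> by at least \<open>(dist w q)\<^sup>2\<close>, and \<open>y\<close> is closer than \<open>q\<close> by at least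
\<open>(dist y q)\<^sup>2\<close> in the limit.
As \<open>w \<noteq> y\<close>, one of the two gains is strict, so that eventually \<open>X n\<close> is closer
to \<open>y\<close> than to \<open>w\<close>; then it projects onto \<open>\<gamma>\<close> before \<open>w\<close>.
Passing through \<open>q\<close> is what allows the limits \<open>F\<close> to be known only on \<open>C\<close>,
while \<open>\<gamma>\<close> may leave \<open>C\<close>.\<close>

lemma weakly_converges_minimizer:
  fixes X :: "nat \<Rightarrow> 'a::hadamard_space"
  assumes C: "closed C" "midconvex C" and X: "\<And>n. X n \<in> C"
    and F: "\<And>c. c \<in> C \<Longrightarrow> (\<lambda>n. dist (X n) c) \<longlonglongrightarrow> F c"
    and y: "y \<in> C" and min: "\<And>c. c \<in> C \<Longrightarrow> (F y)\<^sup>2 + (dist y c)\<^sup>2 \<le> (F c)\<^sup>2"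
  shows "weakly_converges X y"
  unfolding weakly_converges_def
proof (intro ballI tendstoI)
  fix \<gamma> and e :: real assume g: "\<gamma> \<in> geodesics y" and e: "e > 0"
  show "\<forall>\<^sub>F n in sequentially. dist (geodesic_proj \<gamma> (X n)) y < e"
  proof (cases "dist y (\<gamma> 1) < e")
    case True
    have "dist (\<gamma> u) y < e" if "u \<in> {0..1}" for u
    proof -
      have "dist (\<gamma> u) y = u * dist y (\<gamma> 1)" using geodesicsD(4)[OF g that] by (simp add: dist_commute)
      also have "\<dots> \<le> 1 * dist y (\<gamma> 1)" using that by (intro mult_right_mono) auto
      finally show ?thesis using True by simp
    qed
    then have "dist (geodesic_proj \<gamma> z) y < e" for z using geodesic_proj(1)[OF g, of z] by auto
    then show ?thesis by simp
  next
    case False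
    define s where "s = e / dist y (\<gamma> 1)"
    define w where "w = \<gamma> s"
    have s: "s \<in> {0..1}" using False e by (auto simp: s_def divide_le_eq)
    have w: "dist y w = e" using geodesicsD(4)[OF g s] False e by (auto simp: s_def w_def)
    obtain q where q: "q \<in> C" "\<And>c. c \<in> C \<Longrightarrow> (dist w q)\<^sup>2 + (dist q c)\<^sup>2 \<le> (dist w c)\<^sup>2"
      using projection_exists[OF C(1) _ C(2)] y by blast
    have "0 < (dist y q)\<^sup>2 + (dist w q)\<^sup>2"
      using w e by (cases "y = q") (auto simp: dist_commute intro!: add_pos_nonneg)
    then have "(F y)\<^sup>2 < (dist w q)\<^sup>2 + (F q)\<^sup>2" using min[OF q(1)] by linarith
    moreover have "(\<lambda>n. (dist w q)\<^sup>2 + (dist (X n) q)\<^sup>2 - (dist (X n) y)\<^sup>2) \<longlonglongrightarrow>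
        (dist w q)\<^sup>2 + (F q)\<^sup>2 - (F y)\<^sup>2"
      by (intro tendsto_intros F q y)
    ultimately have "\<forall>\<^sub>F n in sequentially. 0 < (dist w q)\<^sup>2 + (dist (X n) q)\<^sup>2 - (dist (X n) y)\<^sup>2"
      by (intro order_tendstoD(1)) auto
    then show ?thesis
    proof eventually_elim
      case (elim n)
      then have "(dist (X n) y)\<^sup>2 < (dist (X n) w)\<^sup>2"
        using q(2)[OF X[of n]] by (simp add: dist_commute)
      then have "dist (X n) y < dist (X n) (\<gamma> s)"
        unfolding w_def by (rule power2_less_imp_less) simp
      then show ?case using geodesic_proj_near_start[OF g s] w by (simp add: w_def dist_commute)
    qed
  qed
qed

lemma convergent_dist_closure:
  fixes X :: "nat \<Rightarrow> 'a::metric_space"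
  assumes D: "\<And>z. z \<in> D \<Longrightarrow> convergent (\<lambda>n. dist (X n) z)" and c: "c \<in> closure D"
  shows "convergent (\<lambda>n. dist (X n) c)"
proof -
  have "Cauchy (\<lambda>n. dist (X n) c)"
  proof (rule metric_CauchyI)
    fix e :: real assume "e > 0"
    then obtain z where z: "z \<in> D" "dist z c < e / 3"
      using c unfolding closure_approachable by (metis divide_pos_pos zero_less_numeral)
    obtain M where M: "\<And>m n. m \<ge> M \<Longrightarrow> n \<ge> M \<Longrightarrow> dist (dist (X m) z) (dist (X n) z) < e / 3"
      using metric_CauchyD[OF convergent_Cauchy[OF D[OF z(1)]], of "e / 3"] \<open>e > 0\<close> by auto
    have "dist (dist (X m) c) (dist (X n) c) < e" if "m \<ge> M" "n \<ge> M" for m n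
      using M[OF that] z(2) dist_triangle[of "X m" c z] dist_triangle[of "X m" z c]
        dist_triangle[of "X n" c z] dist_triangle[of "X n" z c]
      unfolding dist_real_def dist_commute[of c z] by linarith
    then show "\<exists>M. \<forall>m\<ge>M. \<forall>n\<ge>M. dist (dist (X m) c) (dist (X n) c) < e" by blast
  qed
  then show ?thesis by (simp add: Cauchy_convergent_iff)
qed

text \<open>A diagonal argument makes the distances to all points of a countable set converge, hence the
distances to all points of the closed hull \<open>C\<close> of the sequence. The squared limit distance
is uniformly convex on \<open>C\<close>, as a limit of squared distances, so it has a minimiser.\<close>

lemma bounded_weakly_convergent_subsequence:
  fixes X :: "nat \<Rightarrow> 'a::hadamard_space"
  assumes "bounded (range X)"
  obtains r y where "strict_mono r" "weakly_converges (X \<circ> r) y"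
proof -
  obtain D where D: "countable D" "range X \<subseteq> D" "midconvex D"
    using countable_midconvex_hull[of "range X"] by auto
  obtain M where M: "\<And>n. dist (X 0) (X n) \<le> M"
    using assms unfolding bounded_any_center[of _ "X 0"] by auto
  \<comment> \<open>Subtracting \<open>dist (X 0) z\<close> makes the bound uniform in \<open>z\<close>, as the
    diagonal argument demands.\<close>
  have bound: "norm (dist (X n) z - dist (X 0) z) \<le> M" if "z \<in> D" for n z
    using M[of n] abs_dist_diff_le[of "X n" z "X 0"] by (simp add: dist_commute)
  have "\<exists>r::nat \<Rightarrow> nat. strict_mono r \<and>
      (\<forall>z\<in>D. \<exists>l. (\<lambda>n. dist (X (r n)) z - dist (X 0) z) \<longlonglongrightarrow> l)"
    by (rule function_convergent_subsequence[of D "\<lambda>n z. dist (X n) z - dist (X 0) z" M,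
          OF D(1) bound]) auto
  then obtain r :: "nat \<Rightarrow> nat" where r: "strict_mono r"
    and conv: "\<And>z. z \<in> D \<Longrightarrow> \<exists>l. (\<lambda>n. dist (X (r n)) z - dist (X 0) z) \<longlonglongrightarrow> l"
    by blast
  have "convergent (\<lambda>n. dist (X (r n)) z)" if z: "z \<in> D" for z
  proof -
    obtain l where "(\<lambda>n. dist (X (r n)) z - dist (X 0) z) \<longlonglongrightarrow> l" using conv[OF z] by blast
    from tendsto_add[OF this tendsto_const[of "dist (X 0) z"]]
    show ?thesis by (simp add: convergent_def) blast
  qed
  note conv = convergent_dist_closure[OF this]
  define C where "C = closure D"
  define F where "F c = lim (\<lambda>n. dist (X (r n)) c)" for c
  have F: "(\<lambda>n. dist (X (r n)) c) \<longlonglongrightarrow> F c" if "c \<in> C" for c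
    using conv that unfolding F_def C_def convergent_LIMSEQ_iff[symmetric] by blast
  have C: "closed C" "C \<noteq> {}" "midconvex C"
    using D by (auto simp: C_def intro: midconvex_closure)
  have Xr: "(X \<circ> r) n \<in> C" for n using D(2) closure_subset by (auto simp: C_def)
  have "F a \<le> F b + dist a b" if "a \<in> C" "b \<in> C" for a b
  proof (rule LIMSEQ_le[OF F[OF that(1)] tendsto_add[OF F[OF that(2)] tendsto_const]])
    show "\<exists>N. \<forall>n\<ge>N. dist (X (r n)) a \<le> dist (X (r n)) b + dist a b"
      using dist_triangle2[of _ a b] by blast
  qed
  then have "dist (F a) (F b) \<le> 1 * dist a b" if "a \<in> C" "b \<in> C" for a b
    using that by (fastforce simp: dist_real_def abs_le_iff dist_commute)
  then have "1-lipschitz_on C F" by (intro lipschitz_onI) auto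
  then have cont: "continuous_on C (\<lambda>c. (F c)\<^sup>2)"
    by (intro continuous_intros lipschitz_on_continuous_on)
  have mid: "(F (midpt a b))\<^sup>2 \<le> (F a)\<^sup>2 / 2 + (F b)\<^sup>2 / 2 - (dist a b)\<^sup>2 / 4"
    if "a \<in> C" "b \<in> C" for a b
  proof (rule LIMSEQ_le)
    show "(\<lambda>n. (dist (X (r n)) (midpt a b))\<^sup>2) \<longlonglongrightarrow> (F (midpt a b))\<^sup>2"
      using that C(3) by (intro tendsto_intros F) (auto simp: midconvex_def)
    show "(\<lambda>n. (dist (X (r n)) a)\<^sup>2 / 2 + (dist (X (r n)) b)\<^sup>2 / 2 - (dist a b)\<^sup>2 / 4)
        \<longlonglongrightarrow> (F a)\<^sup>2 / 2 + (F b)\<^sup>2 / 2 - (dist a b)\<^sup>2 / 4"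
      by (intro tendsto_intros F that) simp_all
  qed (use midpt_inequality in blast)
  obtain y where "y \<in> C" "\<And>c. c \<in> C \<Longrightarrow> (F y)\<^sup>2 + (dist y c)\<^sup>2 \<le> (F c)\<^sup>2"
    using minimizer_exists[OF C cont _ mid] by auto
  then have "weakly_converges (X \<circ> r) y"
    using F by (intro weakly_converges_minimizer[OF C(1,3) Xr]) auto
  with r show ?thesis by (rule that)
qed

section \<open>Closed convex sets and weak limits\<close>

text \<open>Every point of \<open>C\<close> projects onto the geodesic from \<open>y\<close> to its nearest point
\<open>p\<close> in \<open>C\<close> at the end \<open>p\<close>. So the projections of \<open>X n\<close>, which tend
to \<open>y\<close>, are constantly \<open>p\<close>.\<close>

lemma weakly_converges_closed_midconvex:
  fixes X :: "nat \<Rightarrow> 'a::hadamard_space"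
  assumes C: "closed C" "midconvex C" and X: "\<And>n. X n \<in> C" and lim: "weakly_converges X y"
  shows "y \<in> C"
proof -
  have ne: "C \<noteq> {}" using X by auto
  obtain p where p: "p \<in> C" "\<And>c. c \<in> C \<Longrightarrow> (dist y p)\<^sup>2 + (dist p c)\<^sup>2 \<le> (dist y c)\<^sup>2"
    using projection_exists[OF C(1) ne C(2)] by blast
  define \<gamma> where "\<gamma> = geod y p"
  have g: "\<gamma> \<in> geodesics y" "\<gamma> 1 = p" by (simp_all add: \<gamma>_def geod)
  have "geodesic_proj \<gamma> c = p" if c: "c \<in> C" for c
  proof (rule geodesic_proj_eqI[OF g(1)])
    show "p \<in> \<gamma> ` {0..1}" using g(2) by force
  next
    fix q assume "q \<in> \<gamma> ` {0..1}"
    then obtain s where s: "s \<in> {0..1}" "q = \<gamma> s" by blast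
    have split: "dist y p = dist y q + dist q p"
      using geodesicsD(3)[OF g(1) s(1), of 1] geodesicsD(4)[OF g(1) s(1)] s g(2)
      by (simp add: algebra_simps)
    \<comment> \<open>The nearest point of \<open>C\<close> is \<open>p\<close> for every \<open>q\<close> between \<open>y\<close> and
      \<open>p\<close>: a point of \<open>C\<close> as close to \<open>q\<close> as \<open>p\<close>
      is as close to \<open>y\<close> as \<open>p\<close>, and \<open>p\<close> is the only such point.\<close>
    obtain p' where p': "p' \<in> C" "\<And>c. c \<in> C \<Longrightarrow> (dist q p')\<^sup>2 + (dist p' c)\<^sup>2 \<le> (dist q c)\<^sup>2"
      using projection_exists[OF C(1) ne C(2)] by blast
    have "dist q p' \<le> dist q p"
      by (rule power2_le_imp_le) (use p'(2)[OF p(1)] zero_le_power2[of "dist p' p"] in linarith, simp)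
    then have "dist y p' \<le> dist y p" using dist_triangle[of y p' q] split by linarith
    then have "(dist y p')\<^sup>2 \<le> (dist y p)\<^sup>2" by (rule power_mono) simp
    then have "(dist p p')\<^sup>2 \<le> 0" using p(2)[OF p'(1)] by linarith
    then have "p' = p" by simp
    then have "(dist p c)\<^sup>2 \<le> (dist q c)\<^sup>2" 
      using p'(2)[OF c] zero_le_power2[of "dist q p"] unfolding \<open>p' = p\<close> by linarith
    then show "dist c p \<le> dist c q"
      unfolding dist_commute[of c] by (rule power2_le_imp_le) simp
  qed
  then have "(\<lambda>n. p) \<longlonglongrightarrow> y" using lim g(1) X unfolding weakly_converges_def by force
  then show ?thesis using p(1) LIMSEQ_unique tendsto_const by blast
qed

section \<open>Weakly open covers\<close>

text \<open>As \<open>y\<close> lies on each geodesic that starts at \<open>y\<close>, the projection of \<open>z\<close> is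
within \<open>2 * dist z y\<close> of \<open>y\<close>.\<close>

lemma weakly_open_imp_open:
  fixes U :: "'a::hadamard_space set"
  assumes "weakly_open U" shows "open U"
  unfolding open_dist
proof
  fix y assume "y \<in> U"
  then obtain \<epsilon> F where F: "\<epsilon> > 0" "F \<subseteq> geodesics y" "weak_nbhd y \<epsilon> F \<subseteq> U"
    using assms unfolding weakly_open_def by blast
  have "z \<in> U" if z: "dist z y < \<epsilon> / 2" for z
  proof -
    have "dist y (geodesic_proj \<gamma> z) < \<epsilon>" if "\<gamma> \<in> F" for \<gamma>
    proof -
      have g: "\<gamma> \<in> geodesics y" using F(2) that by blast
      then have "y \<in> \<gamma> ` {0..1}" using geodesicsD(2) by force
      then have "dist z (geodesic_proj \<gamma> z) \<le> dist z y" by (rule geodesic_proj_le[OF g])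
      then show ?thesis
        using z dist_triangle[of y "geodesic_proj \<gamma> z" z] by (simp add: dist_commute)
    qed
    then show ?thesis using F(3) by (auto simp: weak_nbhd_def)
  qed
  then show "\<exists>e>0. \<forall>z. dist z y < e \<longrightarrow> z \<in> U" using F(1) by (intro exI[of _ "\<epsilon> / 2"]) auto
qed

lemma weakly_converges_eventually:
  assumes lim: "weakly_converges X y" and U: "weakly_open U" "y \<in> U"
  shows "\<forall>\<^sub>F n in sequentially. X n \<in> U"
proof -
  obtain \<epsilon> F where F: "\<epsilon> > 0" "finite F" "F \<subseteq> geodesics y" "weak_nbhd y \<epsilon> F \<subseteq> U"
    using U unfolding weakly_open_def by blast
  have "\<forall>\<^sub>F n in sequentially. \<forall>\<gamma>\<in>F. dist (geodesic_proj \<gamma> (X n)) y < \<epsilon>"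
    using lim F unfolding weakly_converges_def
    by (intro eventually_ball_finite ballI tendstoD) auto
  then show ?thesis
    by eventually_elim (use F(4) in \<open>auto simp: weak_nbhd_def dist_commute\<close>)
qed

lemma Lindelof_of_separable_metric:
  fixes \<U> :: "'a::metric_space set set"
  assumes sep: "separable_space (euclidean :: 'a topology)" and op: "\<And>U. U \<in> \<U> \<Longrightarrow> open U"
  obtains \<V> where "countable \<V>" "\<V> \<subseteq> \<U>" "\<Union>\<V> = \<Union>\<U>"
proof -
  obtain D :: "'a set" where D: "countable D" "closure D = UNIV"
    using sep by (auto simp: separable_space_def)
  define B where "B = (\<lambda>(d, n). ball d (1 / real (Suc n))) ` (D \<times> UNIV)"
  define f where "f b = (SOME U. U \<in> \<U> \<and> b \<subseteq> U)" for b
  define \<V> where "\<V> = f ` {b \<in> B. \<exists>U\<in>\<U>. b \<subseteq> U}"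
  have f: "f b \<in> \<U>" "b \<subseteq> f b" if "\<exists>U\<in>\<U>. b \<subseteq> U" for b
    using someI_ex[of "\<lambda>U. U \<in> \<U> \<and> b \<subseteq> U"] that by (auto simp: f_def)
  have "\<Union>\<U> \<subseteq> \<Union>\<V>"
  proof
    fix p assume "p \<in> \<Union>\<U>"
    then obtain U e where U: "U \<in> \<U>" "p \<in> U" and e: "e > 0" "ball p e \<subseteq> U"
      using op open_contains_ball by blast
    obtain n where n: "1 / real (Suc n) < e / 2" using nat_approx_posE[of "e / 2"] e by auto
    obtain d where d: "d \<in> D" "dist d p < 1 / real (Suc n)"
      using D(2) closure_approachable[of p D] by (metis UNIV_I of_nat_0_less_iff zero_less_Suc zero_less_divide_1_iff)
    \<comment> \<open>\<open>p\<close> and \<open>d\<close> are less than \<open>e / 2\<close> apart, so this ball around \<open>d\<close>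
      contains \<open>p\<close> and stays within \<open>e\<close> of it.\<close>
    let ?b = "ball d (1 / real (Suc n))"
    have "?b \<subseteq> ball p e"
    proof
      fix z assume "z \<in> ?b"
      then show "z \<in> ball p e" using d n dist_triangle[of p z d] by (simp add: dist_commute)
    qed
    then have "\<exists>U\<in>\<U>. ?b \<subseteq> U" using U e by blast
    moreover have "?b \<in> B" using d by (force simp: B_def)
    ultimately have "f ?b \<in> \<V>" "?b \<subseteq> f ?b" using f by (auto simp: \<V>_def)
    moreover have "p \<in> ?b" using d by simp
    ultimately show "p \<in> \<Union>\<V>" by blast
  qed
  moreover have "\<V> \<subseteq> \<U>" using f by (auto simp: \<V>_def)
  moreover have "countable \<V>" using D by (auto simp: \<V>_def B_def)
  ultimately show ?thesis by (intro that[of \<V>]) auto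
qed

text \<open>Separability is used for the metric topology, which is finer than the weak one, to reduce to
countable covers \<open>V 0, V 1, \<dots>\<close>. If no finite part covers \<open>C\<close>, choose \<open>X n\<close>
outside the first members up to \<open>V n\<close>; a subsequence tends weakly to a point of \<open>C\<close>,
hence eventually stays in the member of the cover containing that point, a contradiction.\<close>

lemma weakly_open_cover_finite_subcover:
  fixes C :: "'a::hadamard_space set"
  assumes sep: "separable_space (euclidean :: 'a topology)"
    and C: "closed C" "midconvex C" "bounded C"
    and \<U>: "\<And>U. U \<in> \<U> \<Longrightarrow> weakly_open U" "C \<subseteq> \<Union>\<U>"
  obtains \<F> where "finite \<F>" "\<F> \<subseteq> \<U>" "C \<subseteq> \<Union>\<F>"
proof (cases "C = {}")
  case True
  then show ?thesis using that[of "{}"] by simp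
next
  case False
  obtain \<V> where \<V>: "countable \<V>" "\<V> \<subseteq> \<U>" "\<Union>\<V> = \<Union>\<U>"
    by (rule Lindelof_of_separable_metric[OF sep weakly_open_imp_open[OF \<U>(1)]])
  from \<U>(2) have "C \<subseteq> \<Union>\<V>" unfolding \<V>(3) .
  then have "\<V> \<noteq> {}" using False by auto
  then obtain V :: "nat \<Rightarrow> 'a set" where V: "range V = \<V>"
    using uncountable_def \<V>(1) by metis
  show ?thesis
  proof (cases "\<exists>n. C \<subseteq> \<Union> (V ` {..n})")
    case True
    then obtain n where "C \<subseteq> \<Union> (V ` {..n})" by blast
    then show ?thesis using V \<V> by (intro that[of "V ` {..n}"]) auto
  next
    case none: False
    then have "\<exists>z\<in>C. z \<notin> \<Union> (V ` {..n})" for n by blast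
    then obtain X where X: "\<And>n. X n \<in> C" "\<And>n. X n \<notin> \<Union> (V ` {..n})" by metis
    have "bounded (range X)" using C(3) by (rule bounded_subset) (use X in auto)
    then obtain r y where r: "strict_mono r" "weakly_converges (X \<circ> r) y"
      by (rule bounded_weakly_convergent_subsequence)
    have "y \<in> C" using weakly_converges_closed_midconvex[OF C(1,2) _ r(2)] X(1) by simp
    then have "y \<in> \<Union> (range V)" using \<U>(2) unfolding V \<V>(3) by (rule subsetD[rotated])
    then obtain k where k: "y \<in> V k" by blast
    have "V k \<in> \<U>" using V \<V>(2) by blast
    from weakly_converges_eventually[OF r(2) \<U>(1)[OF this] k]
    have "\<forall>\<^sub>F n in sequentially. (X \<circ> r) n \<in> V k" .
    then have "\<forall>\<^sub>F n in sequentially. (X \<circ> r) n \<in> V k \<and> n \<ge> k"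
      using eventually_ge_at_top[of k] by (rule eventually_conj)
    then obtain n where n: "X (r n) \<in> V k" "n \<ge> k"
      unfolding eventually_sequentially by auto
    then have "k \<le> r n" using seq_suble[OF r(1), of n] by linarith
    then show ?thesis using n(1) X(2)[of "r n"] by auto
  qed
qed


section \<open>Passing from geodesics to their endpoints\<close>

text \<open>Geodesics with a common start diverge at most linearly, so they are farthest apart at the end:
evaluation at 1 is an isometry from the geodesics starting at \<open>x\<close> onto the space.\<close>

lemma d1_eq_dist_endpoints:
  fixes x :: "'a::hadamard_space"
  assumes g: "\<gamma> \<in> geodesics x" and h: "\<eta> \<in> geodesics x"
  shows "d1 x \<gamma> \<eta> = dist (\<gamma> 1) (\<eta> 1)"
proof (rule antisym)
  have "dist (\<gamma> t) (\<eta> t) \<le> dist (\<gamma> 1) (\<eta> 1)" if t: "t \<in> {0..1}" for t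
  proof -
    have "dist (\<gamma> t) (\<eta> t) \<le> t * dist (\<gamma> 1) (\<eta> 1)" using dist_geodesics_le[OF g h t] .
    also have "\<dots> \<le> 1 * dist (\<gamma> 1) (\<eta> 1)" using t by (intro mult_right_mono) auto
    finally show ?thesis by simp
  qed
  then have "(SUP t\<in>{0..1}. dist (\<gamma> t) (\<eta> t)) \<le> dist (\<gamma> 1) (\<eta> 1)"
    by (intro cSUP_least) auto
  then show "d1 x \<gamma> \<eta> \<le> dist (\<gamma> 1) (\<eta> 1)" using g h by (simp add: d1_def)
  show "dist (\<gamma> 1) (\<eta> 1) \<le> d1 x \<gamma> \<eta>" using dist_le_d1[OF g h] by simp
qed

definition endpoints :: "(real \<Rightarrow> 'a) set \<Rightarrow> 'a set" where
  "endpoints S = (\<lambda>\<gamma>. \<gamma> 1) ` S"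

lemma mem_endpointsI: "\<gamma> \<in> S \<Longrightarrow> \<gamma> 1 \<in> endpoints S"
  by (simp add: endpoints_def)

lemma mem_endpoints_iff:
  fixes x :: "'a::hadamard_space"
  assumes "S \<subseteq> geodesics x" "\<gamma> \<in> geodesics x"
  shows "\<gamma> 1 \<in> endpoints S \<longleftrightarrow> \<gamma> \<in> S"
proof
  assume "\<gamma> 1 \<in> endpoints S"
  then obtain \<eta> where "\<eta> \<in> S" "\<gamma> 1 = \<eta> 1" by (auto simp: endpoints_def)
  moreover from this have "\<gamma> = \<eta>"
    by (intro geodesics_unique[OF assms(2) refl] subsetD[OF assms(1)]) simp_all
  ultimately show "\<gamma> \<in> S" by simp
qed (rule mem_endpointsI)

lemma closed_endpoints:
  fixes x :: "'a::hadamard_space"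
  assumes S: "S \<subseteq> geodesics x" and cl: "d1_closed x S"
  shows "closed (endpoints S)"
proof -
  interpret Metric_space "geodesics x" "d1 x" by (rule Metric_space_geodesics)
  have "y \<in> endpoints S" if X: "\<And>n. X n \<in> endpoints S" and lim: "X \<longlonglongrightarrow> y" for X y
  proof -
  have gS: "geod x (X n) \<in> S" for n
    using X mem_endpoints_iff[OF S geod(1), of "X n"] by (simp add: geod(2))
  have "(\<lambda>n. dist (X n) y) \<longlonglongrightarrow> 0" using lim by (rule tendsto_dist_iff[THEN iffD1])
  then have "limitin mtopology (\<lambda>n. geod x (X n)) (geod x y) sequentially"
    unfolding limitin_metric_dist_null
    by (simp only: d1_eq_dist_endpoints[OF geod(1) geod(1)] geod simp_thms eventually_True)
  moreover have "range (\<lambda>n. geod x (X n)) \<subseteq> S" using gS by blast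
  moreover note cl[unfolded metric_closedin_iff_sequentially_closed, THEN conjunct2,
      rule_format, of "\<lambda>n. geod x (X n)" "geod x y"]
  ultimately have "geod x y \<in> S" by simp
  then show "y \<in> endpoints S" using mem_endpoints_iff[OF S geod(1), of y] by (simp add: geod(2))
  qed
  then show ?thesis unfolding closed_sequential_limits by blast
qed

lemma bounded_endpoints:
  fixes x :: "'a::hadamard_space"
  assumes "d1_bounded x S"
  shows "bounded (endpoints S)"
proof -
  interpret Metric_space "geodesics x" "d1 x" by (rule Metric_space_geodesics)
  obtain B where "S \<subseteq> geodesics x" "\<And>\<gamma> \<eta>. \<gamma> \<in> S \<Longrightarrow> \<eta> \<in> S \<Longrightarrow> d1 x \<gamma> \<eta> \<le> B"
    using assms unfolding mbounded_alt by blast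
  then have "dist (\<gamma> 1) (\<eta> 1) \<le> B" if "\<gamma> \<in> S" "\<eta> \<in> S" for \<gamma> \<eta>
    using that d1_eq_dist_endpoints[of \<gamma> x \<eta>] by (metis subsetD)
  then have "\<forall>a\<in>endpoints S. \<forall>b\<in>endpoints S. dist a b \<le> B" by (simp add: endpoints_def)
  then show ?thesis unfolding bounded_two_points by (rule exI)
qed

lemma midconvex_endpoints:
  fixes x :: "'a::hadamard_space"
  assumes "geodesically_convex S"
  shows "midconvex (endpoints S)"
  unfolding midconvex_def
proof (intro ballI)
  fix a b assume "a \<in> endpoints S" "b \<in> endpoints S"
  then obtain \<gamma> \<eta> where g: "\<gamma> \<in> S" "\<eta> \<in> S" "a = \<gamma> 1" "b = \<eta> 1" by (auto simp: endpoints_def)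
  then have "geodesic_comb \<gamma> \<eta> (1/2) \<in> S" using assms by (simp add: geodesically_convex_def)
  moreover have "geodesic_comb \<gamma> \<eta> (1/2) 1 = midpt a b"
    using g by (simp add: geodesic_comb_def geod between_eq midpt_def)
  ultimately show "midpt a b \<in> endpoints S" using mem_endpointsI[of "geodesic_comb \<gamma> \<eta> (1/2)" S] by simp
qed

lemma weakly_open_endpoints:
  fixes x :: "'a::hadamard_space"
  assumes "weakly_Gamma_open x U"
  shows "weakly_open (endpoints U)"
  unfolding weakly_open_def
proof
  fix y assume "y \<in> endpoints U"
  then obtain \<gamma> where "\<gamma> \<in> U" "\<gamma> 1 = y" by (auto simp: endpoints_def)
  then obtain \<epsilon> F where F: "\<epsilon> > 0" "finite F" "F \<subseteq> geodesics y"
      "{\<eta> \<in> geodesics x. \<eta> 1 \<in> weak_nbhd y \<epsilon> F} \<subseteq> U"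
    using assms unfolding weakly_Gamma_open_def by blast
  have "z \<in> endpoints U" if "z \<in> weak_nbhd y \<epsilon> F" for z
  proof -
    have "geod x z \<in> U" using F(4) that geod[of x z] by auto
    then show ?thesis using mem_endpointsI[of "geod x z" U] by (simp add: geod(2))
  qed
  with F show "\<exists>\<epsilon>>0. \<exists>F. finite F \<and> F \<subseteq> geodesics y \<and> weak_nbhd y \<epsilon> F \<subseteq> endpoints U"
    by blast
qed

lemma weakly_Gamma_open_of_weakly_open:
  assumes "weakly_open V"
  shows "weakly_Gamma_open x {\<gamma> \<in> geodesics x. \<gamma> 1 \<in> V}"
  unfolding weakly_Gamma_open_def
proof (intro conjI ballI)
  fix \<gamma> assume "\<gamma> \<in> {\<gamma> \<in> geodesics x. \<gamma> 1 \<in> V}"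
  then obtain \<epsilon> F where "\<epsilon> > 0" "finite F" "F \<subseteq> geodesics (\<gamma> 1)" "weak_nbhd (\<gamma> 1) \<epsilon> F \<subseteq> V"
    using assms unfolding weakly_open_def by blast
  then show "\<exists>\<epsilon>>0. \<exists>F. finite F \<and> F \<subseteq> geodesics (\<gamma> 1) \<and>
      {\<eta> \<in> geodesics x. \<eta> 1 \<in> weak_nbhd (\<gamma> 1) \<epsilon> F} \<subseteq> {\<gamma> \<in> geodesics x. \<gamma> 1 \<in> V}"
    by blast
qed auto

section \<open>Separation and compactness\<close>

text \<open>Let \<open>P\<close> be the projection onto the segment between \<open>y\<close> and \<open>z\<close>. By weak
properness there are weakly open neighbourhoods of \<open>y\<close> and of \<open>z\<close> that \<open>P\<close>
maps into the two balls of radius half the distance between \<open>y\<close> and \<open>z\<close>, and these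
balls are disjoint.\<close>

lemma weakly_proper_separation:
  fixes y z :: "'a::hadamard_space"
  assumes wp: "weakly_proper TYPE('a)" and "y \<noteq> z"
  obtains V W where "weakly_open V" "weakly_open W" "y \<in> V" "z \<in> W" "V \<inter> W = {}"
proof -
  define \<gamma> where "\<gamma> = geod y z"
  define \<rho> where "\<rho> = restrict (\<lambda>t. \<gamma> (1 - t)) {0..1}"
  have g: "\<gamma> \<in> geodesics y" "\<gamma> 1 = z" by (simp_all add: \<gamma>_def geod)
  have r: "\<rho> \<in> geodesics z" unfolding \<rho>_def by (rule geodesics_reverse[OF g])
  \<comment> \<open>Weak properness at \<open>z\<close> speaks of geodesics that start at \<open>z\<close>; the reversed
    geodesic has the same image, hence the same projection.\<close>
  have "\<rho> ` {0..1} = (\<lambda>t. \<gamma> (1 - t)) ` {0..1}" by (simp add: \<rho>_def)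
  also have "\<dots> = \<gamma> ` ((\<lambda>t. 1 - t) ` {0..1})" by (simp only: image_image)
  also have "(\<lambda>t. 1 - t) ` {0..1} = {0..1::real}" by simp
  finally have same: "geodesic_proj \<rho> = geodesic_proj \<gamma>" by (simp add: geodesic_proj_def fun_eq_iff)
  have pos: "dist y z / 2 > 0" using \<open>y \<noteq> z\<close> by simp
  obtain V where V: "weakly_open V" "y \<in> V" "V \<subseteq> {w. dist y (geodesic_proj \<gamma> w) < dist y z / 2}"
    using wp g(1) pos unfolding weakly_proper_def openin_weak_topology by blast
  obtain W where W: "weakly_open W" "z \<in> W" "W \<subseteq> {w. dist z (geodesic_proj \<gamma> w) < dist y z / 2}"
    using wp r pos unfolding weakly_proper_def openin_weak_topology same[symmetric] by blast
  have "w \<notin> W" if "w \<in> V" for w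
  proof
    assume "w \<in> W"
    then show False
      using that V(3) W(3) dist_triangle2[of y z "geodesic_proj \<gamma> w"] by fastforce
  qed
  then show ?thesis using that[OF V(1) W(1) V(2) W(2)] by blast
qed

lemma Hausdorff_weak_Gamma_topology:
  fixes x :: "'a::hadamard_space"
  assumes "weakly_proper TYPE('a)"
  shows "Hausdorff_space (weak_Gamma_topology x)"
  unfolding Hausdorff_space_def topspace_weak_Gamma_topology openin_weak_Gamma_topology
proof (intro allI impI, elim conjE)
  fix \<gamma> \<eta> assume g: "\<gamma> \<in> geodesics x" "\<eta> \<in> geodesics x" and "\<gamma> \<noteq> \<eta>"
  then have "\<gamma> 1 \<noteq> \<eta> 1" using geodesics_unique by metis
  then obtain V W where "weakly_open V" "weakly_open W" "\<gamma> 1 \<in> V" "\<eta> 1 \<in> W" "V \<inter> W = {}"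
    by (rule weakly_proper_separation[OF assms])
  then show "\<exists>U V. weakly_Gamma_open x U \<and> weakly_Gamma_open x V \<and> \<gamma> \<in> U \<and> \<eta> \<in> V \<and> disjnt U V"
    using g by (intro exI[of _ "{\<gamma> \<in> geodesics x. \<gamma> 1 \<in> V}"] exI[of _ "{\<gamma> \<in> geodesics x. \<gamma> 1 \<in> W}"])
      (auto simp: disjnt_def weakly_Gamma_open_of_weakly_open)
qed

lemma bounded_weakly_Gamma_convergent_subsequence:
  fixes x :: "'a::hadamard_space"
  assumes "d1_bounded x (range g)"
  obtains r \<gamma> where "strict_mono (r :: nat \<Rightarrow> nat)" "\<gamma> \<in> geodesics x" "weakly_Gamma_converges (g \<circ> r) \<gamma>"
proof -
  have "range (\<lambda>n. g n 1) = endpoints (range g)" by (auto simp: endpoints_def)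
  then have "bounded (range (\<lambda>n. g n 1))" using bounded_endpoints[OF assms] by simp
  then obtain r y where r: "strict_mono r" "weakly_converges ((\<lambda>n. g n 1) \<circ> r) y"
    by (rule bounded_weakly_convergent_subsequence)
  show ?thesis
    by (rule that[OF r(1) geod(1)[of x y]])
       (use r(2) in \<open>simp add: weakly_Gamma_converges_def geod o_def\<close>)
qed

lemma closed_convex_weakly_Gamma_seq_closed:
  fixes x :: "'a::hadamard_space"
  assumes S: "S \<subseteq> geodesics x" "d1_closed x S" "geodesically_convex S"
  shows "weakly_Gamma_seq_closed x S"
  unfolding weakly_Gamma_seq_closed_def
proof (intro allI ballI impI, elim conjE)
  fix g \<gamma> assume \<gamma>: "\<gamma> \<in> geodesics x" and g: "range g \<subseteq> S" "weakly_Gamma_converges g \<gamma>"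
  have "\<gamma> 1 \<in> endpoints S"
  proof (rule weakly_converges_closed_midconvex)
    show "closed (endpoints S)" using closed_endpoints S by blast
    show "midconvex (endpoints S)" using midconvex_endpoints S by blast
    show "weakly_converges (\<lambda>n. g n 1) (\<gamma> 1)" using g(2) by (simp add: weakly_Gamma_converges_def)
    show "g n 1 \<in> endpoints S" for n using g(1) by (auto simp: endpoints_def)
  qed
  then show "\<gamma> \<in> S" using mem_endpoints_iff[OF S(1) \<gamma>] by simp
qed

lemma bounded_closed_convex_weakly_Gamma_seq_compact:
  fixes x :: "'a::hadamard_space"
  assumes S: "S \<subseteq> geodesics x" "d1_closed x S" "geodesically_convex S" and bd: "d1_bounded x S"
  shows "weakly_Gamma_seq_compact S"
  unfolding weakly_Gamma_seq_compact_def
proof (intro allI impI)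
  fix g :: "nat \<Rightarrow> real \<Rightarrow> 'a" assume g: "range g \<subseteq> S"
  interpret Metric_space "geodesics x" "d1 x" by (rule Metric_space_geodesics)
  obtain r \<gamma> where r: "strict_mono (r :: nat \<Rightarrow> nat)" "\<gamma> \<in> geodesics x" "weakly_Gamma_converges (g \<circ> r) \<gamma>"
    by (rule bounded_weakly_Gamma_convergent_subsequence[OF mbounded_subset[OF bd g]])
  have "range (g \<circ> r) \<subseteq> S" using g by auto
  then have "\<gamma> \<in> S"
    using closed_convex_weakly_Gamma_seq_closed[OF S] r unfolding weakly_Gamma_seq_closed_def by blast
  then show "\<exists>r. \<exists>\<gamma>\<in>S. strict_mono r \<and> weakly_Gamma_converges (g \<circ> r) \<gamma>" using r by blast
qed

lemma bounded_closed_convex_weak_Gamma_compact: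
  fixes x :: "'a::hadamard_space"
  assumes sep: "separable_space (euclidean :: 'a topology)"
    and S: "S \<subseteq> geodesics x" "d1_closed x S" "geodesically_convex S" and bd: "d1_bounded x S"
  shows "compactin (weak_Gamma_topology x) S"
  unfolding compactin_def topspace_weak_Gamma_topology openin_weak_Gamma_topology
proof (intro conjI allI impI S(1), elim conjE)
  fix \<U> assume \<U>: "Ball \<U> (weakly_Gamma_open x)" and cover: "S \<subseteq> \<Union>\<U>"
  have "\<And>E. E \<in> endpoints ` \<U> \<Longrightarrow> weakly_open E" using \<U> weakly_open_endpoints by blast
  moreover have "endpoints S \<subseteq> \<Union> (endpoints ` \<U>)" using cover by (auto simp: endpoints_def)
  ultimately obtain \<E> where \<E>: "finite \<E>" "\<E> \<subseteq> endpoints ` \<U>" "endpoints S \<subseteq> \<Union>\<E>"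
    by (rule weakly_open_cover_finite_subcover[OF sep closed_endpoints[OF S(1,2)]
          midconvex_endpoints[OF S(3)] bounded_endpoints[OF bd]])
  obtain \<F> where \<F>: "\<F> \<subseteq> \<U>" "finite \<F>" "\<E> = endpoints ` \<F>"
    using finite_subset_image[OF \<E>(1,2)] by blast
  have "S \<subseteq> \<Union>\<F>"
  proof
    fix \<gamma> assume \<gamma>: "\<gamma> \<in> S"
    then obtain U where U: "U \<in> \<F>" "\<gamma> 1 \<in> endpoints U"
      using \<E>(3) \<F>(3) by (auto simp: endpoints_def)
    then have "U \<subseteq> geodesics x" using \<U> \<F>(1) by (auto simp: weakly_Gamma_open_def)
    then show "\<gamma> \<in> \<Union>\<F>" using mem_endpoints_iff U \<gamma> S(1) by blast
  qed
  then show "\<exists>\<F>. finite \<F> \<and> \<F> \<subseteq> \<U> \<and> S \<subseteq> \<Union>\<F>" using \<F> by blast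
qed

theorem theorem11:
  fixes x :: "'a::hadamard_space"
  shows
    "(weakly_proper TYPE('a) \<longrightarrow> Hausdorff_space (weak_Gamma_topology x)) \<and>
     (\<forall>g. range g \<subseteq> geodesics x \<and> d1_bounded x (range g) \<longrightarrow>
        (\<exists>r. \<exists>\<gamma>\<in>geodesics x.
           strict_mono (r :: nat \<Rightarrow> nat) \<and> weakly_Gamma_converges (g \<circ> r) \<gamma>)) \<and>
     (\<forall>S\<subseteq>geodesics x. d1_closed x S \<and> geodesically_convex S \<longrightarrow>
        weakly_Gamma_seq_closed x S \<and>
        (d1_bounded x S \<longrightarrow> weakly_Gamma_seq_compact S)) \<and>
     (separable_space (euclidean :: 'a topology) \<longrightarrow>
        (\<forall>S\<subseteq>geodesics x. d1_bounded x S \<and> d1_closed x S \<and> geodesically_convex S \<longrightarrow>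
           compactin (weak_Gamma_topology x) S))"
proof (intro conjI impI allI, goal_cases)
  case 1
  then show ?case by (rule Hausdorff_weak_Gamma_topology)
next
  case (2 g)
  then show ?case using bounded_weakly_Gamma_convergent_subsequence[of x g] by metis
next
  case (3 S)
  then show ?case using closed_convex_weakly_Gamma_seq_closed by blast
next
  case (4 S)
  then show ?case using bounded_closed_convex_weakly_Gamma_seq_compact by blast
next
  case (5 S)
  then show ?case using bounded_closed_convex_weak_Gamma_compact by blast
qed

end
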